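(* Let $G$ be a finite, simple, undirected, connected graph. If $G$ has the partially augmented consecutive ones property ( *-C1P), then $pe(G)\leq 2$.
   Context: A $0/1$ matrix has the consecutive ones property (C1P, for columns) if there is a permutation of its rows that places the 1s consecutively in every column. An $n$-vertex graph $G$ has the partially augmented consecutive ones property ( *-C1P) if there is an adjacency matrix $(A_{i,j})_{(i,j)\in[n]^2}$ of $G$ and a matrix $(A^*_{i,j})_{(i,j)\in[n]^2}$ with $A^*_{i,j}=A_{i,j}$ for all $i\neq j$ and $A^*_{i,i}\in\{0,1\}$ for all $i$, such that $A^*$ has the C1P. Equivalently, there is a total ordering of $V(G)$ such that for every vertex $v$, either the open neighborhood $N(v)$ or the closed neighborhood $N[v]=N(v)\cup\{v\}$ is a set of consecutive vertices in the ordering. For vertices $u,v$ of $G$, $d(u,v)$ is the minimum length (number of edges) of a path between $u$ and $v$. For a subgraph $H$ of $G$ and a vertex $u$, $d(u,H)=\min_{v\in V(H)} d(u,v)$. A path $P$ in $G$ is a subgraph with distinct vertices $v_0,\dots,v_\ell$, $\ell\geq 0$, with $v_i$ adjacent to $v_{i+1}$ for $0\le i<\ell$ (it need not be induced). The eccentricity of a path $P$ of $G$ is $ecc(P)=\max\{d(u,P): u\in V(G)\}$, and the path eccentricity of $G$ is $pe(G)=\min\{ecc(P): P \text{ a path of } G\}$. *)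

theory Defs
  imports
    "Graph_Theory.Digraph_Component"
    "Graph_Theory.Vertex_Walk"
    "Jordan_Normal_Form.Matrix"
    "HOL-Combinatorics.Permutations"
    "HOL-Library.Extended_Nat"
begin

text \<open>
  Graphs are the finite symmetric loop-free digraphs without parallel arcs of locale
  \<^locale>\<open>graph\<close>: an undirected edge is a pair of opposite arcs. A path is the list of
  its vertices, \<^const>\<open>vpath\<close>; it has at least one vertex and need not be induced.
\<close>

section \<open>The consecutive ones property\<close>

definition zero_one_mat :: "nat mat \<Rightarrow> bool" where
  "zero_one_mat A \<longleftrightarrow> elements_mat A \<subseteq> {0, 1}"

definition permute_rows :: "(nat \<Rightarrow> nat) \<Rightarrow> 'a mat \<Rightarrow> 'a mat" where
  "permute_rows \<pi> A = mat (dim_row A) (dim_col A) (\<lambda>(i, j). A $$ (\<pi> i, j))"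

definition ones_consecutive_in_columns :: "nat mat \<Rightarrow> bool" where
  "ones_consecutive_in_columns A \<longleftrightarrow>
     (\<forall>j < dim_col A. \<forall>i k l. i \<le> k \<longrightarrow> k \<le> l \<longrightarrow> l < dim_row A \<longrightarrow>
        A $$ (i, j) = 1 \<longrightarrow> A $$ (l, j) = 1 \<longrightarrow> A $$ (k, j) = 1)"

definition C1P :: "nat mat \<Rightarrow> bool" where
  "C1P A \<longleftrightarrow> zero_one_mat A \<and>
     (\<exists>\<pi>. \<pi> permutes {0..<dim_row A} \<and> ones_consecutive_in_columns (permute_rows \<pi> A))"

definition is_adjacency_mat :: "('a, 'b) pre_digraph \<Rightarrow> nat mat \<Rightarrow> bool" where
  "is_adjacency_mat G A \<longleftrightarrow>
     (\<exists>f. bij_betw f {0..<card (verts G)} (verts G) \<and>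
        A = mat (card (verts G)) (card (verts G))
              (\<lambda>(i, j). if f i \<rightarrow>\<^bsub>G\<^esub> f j then 1 else 0))"

definition partially_augmented_C1P :: "('a, 'b) pre_digraph \<Rightarrow> bool" where
  "partially_augmented_C1P G \<longleftrightarrow>
     (\<exists>A A'. is_adjacency_mat G A \<and>
        A' \<in> carrier_mat (card (verts G)) (card (verts G)) \<and>
        (\<forall>i < card (verts G). \<forall>j < card (verts G). i \<noteq> j \<longrightarrow> A' $$ (i, j) = A $$ (i, j)) \<and>
        (\<forall>i < card (verts G). A' $$ (i, i) \<in> {0, 1}) \<and>
        C1P A')"

section \<open>Path eccentricity\<close>

text \<open>
  Minima and maxima are taken as infima and suprema in \<^typ>\<open>enat\<close>. Infima of nonempty sets
  are attained there, and so are suprema of nonempty finite sets. An infimum over the empty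
  set is \<open>\<infinity>\<close>, so a missing path never makes a distance or an eccentricity small.
\<close>

definition graph_dist :: "('a, 'b) pre_digraph \<Rightarrow> 'a \<Rightarrow> 'a \<Rightarrow> enat" where
  "graph_dist G u v = (INF p \<in> {p. vpath p G \<and> hd p = u \<and> last p = v}. enat (vwalk_length p))"

text \<open>The distance to a subgraph depends only on its vertex set \<open>S\<close>.\<close>

definition graph_dist_set :: "('a, 'b) pre_digraph \<Rightarrow> 'a \<Rightarrow> 'a set \<Rightarrow> enat" where
  "graph_dist_set G u S = (INF v \<in> S. graph_dist G u v)"

definition path_ecc :: "('a, 'b) pre_digraph \<Rightarrow> 'a list \<Rightarrow> enat" where
  "path_ecc G p = (SUP u \<in> verts G. graph_dist_set G u (set p))"

definition path_eccentricity :: "('a, 'b) pre_digraph \<Rightarrow> enat" where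
  "path_eccentricity G = (INF p \<in> {p. vpath p G}. path_ecc G p)"

end

theory Submission
  imports Defs
begin

text \<open>
  The rows of the augmented matrix order the vertices so that every neighbourhood is an interval,
  up to the vertex itself. Hence two neighbours of a vertex \<open>x\<close> dominate, through \<open>x\<close>, every vertex
  placed between them. Let \<open>x\<^sub>0, \<dots>, x\<^sub>k\<close> be any path from the first vertex to the last. The vertices
  \<open>x\<^sub>i\<close> and \<open>x\<^sub>i\<^sub>+\<^sub>2\<close> have the common neighbour \<open>x\<^sub>i\<^sub>+\<^sub>1\<close>, so the path dominates every vertex that lies
  between two of its vertices of equal parity (\<open>dominated_between_same_parity\<close>). If \<open>k\<close> is even, these
  are all vertices. If \<open>k\<close> is odd, the even vertices take care of everything up to \<open>a = x\<^sub>k\<^sub>-\<^sub>1\<close> and the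
  odd ones of everything from \<open>b = x\<^sub>1\<close> on. Only the gap strictly between \<open>a\<close> and \<open>b\<close> can cause trouble.

  Suppose that some vertex is at distance more than two from the path. By connectedness there is
  then a gap vertex with one neighbour outside the gap and one inside, and the interval spanned by
  these two contains \<open>a\<close> or \<open>b\<close>; so \<open>a\<close> or \<open>b\<close> has a neighbour in the gap
  (\<open>gap_attached_to_boundary\<close>). Since \<open>a\<close> is also adjacent to the last vertex and \<open>b\<close> to the first,
  convexity makes \<open>a\<close> and \<open>b\<close> adjacent, and then \<open>b\<close> alone dominates everything up to \<open>a\<close>, and \<open>a\<close>
  everything from \<open>b\<close> on. The long path is now dispensable: the edge between \<open>a\<close> and \<open>b\<close> starts
  a new path that spirals into the gap, always moving to the gap vertex that is closest to the
  current end among its neighbours there (\<open>path_from_bridging_edge\<close>, \<open>spiral_into_gap\<close>). The same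
  lemma on gaps shows that the spiral can be continued as long as some vertex is at distance more
  than two from it.
\<close>

section \<open>Vertex orderings with convex neighbourhoods\<close>

text \<open>
  The side condition \<open>w \<noteq> v\<close> leaves it open whether the interval is the open or the closed
  neighbourhood of \<open>v\<close>, which is the freedom in the choice of the diagonal entry. Positions are
  integers so that negation reverses the order, which happens at every step of the spiral.
\<close>
locale convex_neighbourhoods = graph G for G :: "('a, 'b) pre_digraph" +
  fixes pos :: "'a \<Rightarrow> int"
  assumes inj: "inj_on pos (verts G)"
    and convex: "x \<rightarrow>\<^bsub>G\<^esub> v \<Longrightarrow> y \<rightarrow>\<^bsub>G\<^esub> v \<Longrightarrow> w \<in> verts G \<Longrightarrow> w \<noteq> v \<Longrightarrow>
    pos x \<le> pos w \<Longrightarrow> pos w \<le> pos y \<Longrightarrow> w \<rightarrow>\<^bsub>G\<^esub> v"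

definition dominated :: "('a, 'b) pre_digraph \<Rightarrow> 'a set \<Rightarrow> 'a \<Rightarrow> bool" where
  "dominated G S w \<longleftrightarrow> (\<exists>x\<in>S. w = x \<or> w \<rightarrow>\<^bsub>G\<^esub> x)"

definition within_two :: "('a, 'b) pre_digraph \<Rightarrow> 'a set \<Rightarrow> 'a \<Rightarrow> bool" where
  "within_two G S w \<longleftrightarrow> dominated G S w \<or> (\<exists>u. w \<rightarrow>\<^bsub>G\<^esub> u \<and> dominated G S u)"

lemma vwalk_nth_adj:
  assumes "vwalk p G" "Suc i < length p"
  shows "p ! i \<rightarrow>\<^bsub>G\<^esub> p ! Suc i"
proof -
  have "Suc i < length p \<Longrightarrow> (p ! i, p ! Suc i) \<in> set (vwalk_arcs p)"
    by (induction p arbitrary: i rule: vwalk_arcs.induct) (auto simp: nth_Cons split: nat.splits)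
  then show ?thesis using assms by (auto simp: vwalk_def)
qed

lemma (in graph) adj_sym: "u \<rightarrow>\<^bsub>G\<^esub> v \<Longrightarrow> v \<rightarrow>\<^bsub>G\<^esub> u"
  using arcs_ends_symmetric[OF sym_arcs] by blast

context convex_neighbourhoods
begin

lemma reversed: "convex_neighbourhoods G (\<lambda>v. - pos v)"
proof unfold_locales
  show "inj_on (\<lambda>v. - pos v) (verts G)" using inj by (auto simp: inj_on_def)
next
  fix x v y w
  assume "x \<rightarrow>\<^bsub>G\<^esub> v" "y \<rightarrow>\<^bsub>G\<^esub> v" "w \<in> verts G" "w \<noteq> v" "- pos x \<le> - pos w" "- pos w \<le> - pos y"
  then show "w \<rightarrow>\<^bsub>G\<^esub> v" using convex[of y v x w] by simp
qed

text \<open>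
  A walk that jumps from \<open>p ! j\<close> to \<open>p ! (j + 2)\<close> passes over \<open>w\<close> at some \<open>j\<close> of the parity of \<open>i\<close>, and
  the vertex skipped in that jump is adjacent to both ends of it, hence equal or adjacent to \<open>w\<close>. For
  \<open>m = 0\<close> there is no jump, and it is injectivity of the positions that puts \<open>w\<close> on the walk.
\<close>
lemma dominated_between_same_parity:
  assumes "vwalk p G" "i + 2 * m < length p" "w \<in> verts G"
    and "pos (p ! i) \<le> pos w" "pos w \<le> pos (p ! (i + 2 * m))"
  shows "dominated G (set p) w"
  using assms
proof (induction m)
  case 0
  moreover from this have "p ! i \<in> set p" "p ! i \<in> verts G" by (auto simp: vwalk_def)
  ultimately have "w = p ! i" using inj by (auto dest: inj_onD)
  with \<open>p ! i \<in> set p\<close> show ?case by (auto simp: dominated_def)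
next
  case (Suc m)
  let ?j = "i + 2 * m"
  have len: "Suc (Suc ?j) < length p" using Suc.prems by simp
  show ?case
  proof (cases "pos w \<le> pos (p ! ?j)")
    case True
    then show ?thesis using Suc by simp
  next
    case False
    have "p ! ?j \<rightarrow>\<^bsub>G\<^esub> p ! Suc ?j" "p ! Suc (Suc ?j) \<rightarrow>\<^bsub>G\<^esub> p ! Suc ?j"
      using len vwalk_nth_adj[OF Suc.prems(1)] adj_sym by auto
    then have "w = p ! Suc ?j \<or> w \<rightarrow>\<^bsub>G\<^esub> p ! Suc ?j"
      using convex[of "p ! ?j" "p ! Suc ?j" "p ! Suc (Suc ?j)" w] False Suc.prems by auto
    moreover have "p ! Suc ?j \<in> set p" using len by simp
    ultimately show ?thesis unfolding dominated_def by blast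
  qed
qed

text \<open>
  If neither \<open>a\<close> nor \<open>b\<close> had a neighbour in the gap, no gap vertex would have neighbours both
  outside and inside the gap, as the interval spanned by them would contain \<open>a\<close> or \<open>b\<close>. The gap vertices all of whose neighbours lie in the gap are then
  closed under adjacency. A vertex at distance more than two from \<open>S\<close> is one of them, so it could
  not reach \<open>a\<close>.
\<close>
lemma gap_attached_to_boundary:
  assumes conn: "strongly_connected G"
    and a: "a \<in> verts G" and b: "b \<in> verts G"
    and outside: "\<And>w. w \<in> verts G \<Longrightarrow> pos w \<le> pos a \<or> pos b \<le> pos w \<Longrightarrow> dominated G S w"
    and far: "w \<in> verts G" "\<not> within_two G S w"
  obtains g where "pos a < pos g" "pos g < pos b" "g \<rightarrow>\<^bsub>G\<^esub> a \<or> g \<rightarrow>\<^bsub>G\<^esub> b"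
proof (rule ccontr)
  assume "\<not> thesis"
  then have none: "\<not> g \<rightarrow>\<^bsub>G\<^esub> a" "\<not> g \<rightarrow>\<^bsub>G\<^esub> b" if "pos a < pos g" "pos g < pos b" for g
    using that \<open>\<And>g. pos a < pos g \<Longrightarrow> pos g < pos b \<Longrightarrow> g \<rightarrow>\<^bsub>G\<^esub> a \<or> g \<rightarrow>\<^bsub>G\<^esub> b \<Longrightarrow> thesis\<close> by blast+
  define inside where "inside v \<longleftrightarrow> pos a < pos v \<and> pos v < pos b" for v
  have closed: "inside v' \<and> (\<forall>u. v' \<rightarrow>\<^bsub>G\<^esub> u \<longrightarrow> inside u)"
    if "inside v" "\<forall>u. v \<rightarrow>\<^bsub>G\<^esub> u \<longrightarrow> inside u" "v \<rightarrow>\<^bsub>G\<^esub> v'" for v v'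
  proof (intro conjI allI impI)
    show v': "inside v'" using that by blast
    fix u assume u: "v' \<rightarrow>\<^bsub>G\<^esub> u"
    have v'_ne: "a \<noteq> v'" "b \<noteq> v'" using v' by (auto simp: inside_def)
    show "inside u"
    proof (rule ccontr)
      assume "\<not> inside u"
      then consider "pos u \<le> pos a" | "pos b \<le> pos u" unfolding inside_def by linarith
      then have "a \<rightarrow>\<^bsub>G\<^esub> v' \<or> b \<rightarrow>\<^bsub>G\<^esub> v'"
      proof cases
        case 1
        then show ?thesis
          using convex[OF adj_sym[OF u] \<open>v \<rightarrow>\<^bsub>G\<^esub> v'\<close> a v'_ne(1)] \<open>inside v\<close> by (simp add: inside_def)
      next
        case 2
        then show ?thesis
          using convex[OF \<open>v \<rightarrow>\<^bsub>G\<^esub> v'\<close> adj_sym[OF u] b v'_ne(2)] \<open>inside v\<close> by (simp add: inside_def)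
      qed
      then show False using none[of v'] v' adj_sym by (auto simp: inside_def)
    qed
  qed
  have in_gap: "inside v" if "v \<in> verts G" "\<not> dominated G S v" for v
    using outside[of v] that unfolding inside_def by linarith
  have start: "inside w \<and> (\<forall>u. w \<rightarrow>\<^bsub>G\<^esub> u \<longrightarrow> inside u)"
    using far in_gap adj_in_verts unfolding within_two_def by blast
  have "w \<rightarrow>\<^sup>*\<^bsub>G\<^esub> a" using conn far(1) a by (auto simp: strongly_connected_def)
  then have "inside a \<and> (\<forall>u. a \<rightarrow>\<^bsub>G\<^esub> u \<longrightarrow> inside u)"
  proof (induction rule: reachable_induct)
    case base
    show ?case by (rule start)
  next
    case (step x y)
    then show ?case using closed by blast
  qed
  then show False by (simp add: inside_def)
qed

end

section \<open>Spiralling into a gap\<close>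

text \<open>
  The path is extended at its head \<open>a\<close>. The last hypothesis says that \<open>a\<close> was chosen as far inside as
  possible among the neighbours of \<open>b\<close> that precede \<open>b\<close>, so that only \<open>a\<close> can have neighbours in the gap. Prepending the
  neighbour \<open>g\<close> of \<open>a\<close> that is closest to \<open>a\<close> leaves the smaller gap between \<open>a\<close> and \<open>g\<close>, because \<open>a\<close>
  dominates everything between its neighbours \<open>g\<close> and \<open>b\<close>. Seen in the reversed order, \<open>g\<close> and \<open>a\<close>
  satisfy the hypotheses on \<open>a\<close> and \<open>b\<close>: the choice of \<open>g\<close> is the extremality of the new head.
\<close>
lemma spiral_into_gap:
  fixes G :: "('a, 'b) pre_digraph"
  assumes "convex_neighbourhoods G pos" "strongly_connected G"
    and "vpath p G" "hd p = a" "b \<rightarrow>\<^bsub>G\<^esub> a" "pos a < pos b"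
    and "\<And>x. x \<in> set p \<Longrightarrow> pos x \<le> pos a \<or> pos b \<le> pos x"
    and "\<And>w. w \<in> verts G \<Longrightarrow> pos w \<le> pos a \<or> pos b \<le> pos w \<Longrightarrow> dominated G (set p) w"
    and "\<And>g. g \<rightarrow>\<^bsub>G\<^esub> b \<Longrightarrow> pos g < pos b \<Longrightarrow> pos g \<le> pos a"
  shows "\<exists>q. vpath q G \<and> (\<forall>w\<in>verts G. within_two G (set q) w)"
  using assms
proof (induction "nat (pos b - pos a)" arbitrary: pos a b p rule: less_induct)
  case less
  interpret convex_neighbourhoods G pos by (rule less.prems)
  show ?case
  proof (cases "\<forall>w\<in>verts G. within_two G (set p) w")
    case True
    then show ?thesis using less.prems(3) by blast
  next
    case False
    then obtain w where w: "w \<in> verts G" "\<not> within_two G (set p) w" by blast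
    have ab: "a \<in> verts G" "b \<in> verts G" using less.prems(5) adj_in_verts by auto
    define N where "N = {g. g \<rightarrow>\<^bsub>G\<^esub> a \<and> pos a < pos g \<and> pos g < pos b}"
    obtain g0 where "pos a < pos g0" "pos g0 < pos b" "g0 \<rightarrow>\<^bsub>G\<^esub> a \<or> g0 \<rightarrow>\<^bsub>G\<^esub> b"
      using gap_attached_to_boundary[OF less.prems(2) ab less.prems(8) w] by blast
    then have "g0 \<in> N" using less.prems(9)[of g0] by (auto simp: N_def)
    moreover have "finite N"
      by (rule finite_subset[OF _ finite_verts]) (auto simp: N_def adj_in_verts)
    ultimately obtain g where "is_arg_min pos (\<lambda>g. g \<in> N) g"
      using ex_is_arg_min_if_finite[of N pos] by blast
    then have g: "g \<rightarrow>\<^bsub>G\<^esub> a" "pos a < pos g" "pos g < pos b"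
      and g_min: "\<And>h. h \<in> N \<Longrightarrow> pos g \<le> pos h"
      by (auto simp: is_arg_min_linorder N_def)
    show ?thesis
    proof (rule less.hyps[where pos = "\<lambda>v. - pos v" and a = g and b = a and p = "g # p"])
      show "nat (- pos a - - pos g) < nat (pos b - pos a)" using g by simp
      show "convex_neighbourhoods G (\<lambda>v. - pos v)" by (rule reversed)
      have "g \<notin> set p" using less.prems(7)[of g] g by auto
      moreover have "vwalk (g # p) G"
        using less.prems(3,4) g(1) by (intro vwalk_wf_digraph_consI) (auto simp: vpath_def)
      ultimately show "vpath (g # p) G" using less.prems(3) by (auto simp: vpath_def)
      show "a \<rightarrow>\<^bsub>G\<^esub> g" using g(1) by (rule adj_sym)
      show "- pos x \<le> - pos g \<or> - pos a \<le> - pos x" if "x \<in> set (g # p)" for x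
        using that less.prems(7)[of x] g by auto
      show "dominated G (set (g # p)) v" if "v \<in> verts G" "- pos v \<le> - pos g \<or> - pos a \<le> - pos v" for v
      proof (cases "pos v \<le> pos a \<or> pos b \<le> pos v")
        case True
        then show ?thesis using less.prems(8)[OF that(1)] by (auto simp: dominated_def)
      next
        case False
        then have "v \<rightarrow>\<^bsub>G\<^esub> a"
          using convex[OF g(1) less.prems(5) that(1)] that(2) by auto
        moreover have "a \<in> set p" using less.prems(3,4) by (auto simp: vpath_def vwalk_def)
        ultimately show ?thesis by (auto simp: dominated_def)
      qed
      show "- pos h \<le> - pos g" if "h \<rightarrow>\<^bsub>G\<^esub> a" "- pos h < - pos a" for h
        using that g g_min[of h] by (cases "pos h < pos b") (auto simp: N_def)
    qed (use less.prems g in auto)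
  qed
qed

text \<open>
  A spiral has to start with a head \<open>c\<close> that is the innermost neighbour of \<open>b\<close>. It may differ from \<open>a\<close>,
  which then stays on the path behind \<open>b\<close> to dominate the vertices from \<open>b\<close> on; those up to \<open>c\<close> are
  all adjacent to \<open>b\<close>.
\<close>
lemma path_from_bridging_edge:
  fixes G :: "('a, 'b) pre_digraph"
  assumes "convex_neighbourhoods G pos" and conn: "strongly_connected G"
    and ab: "a \<rightarrow>\<^bsub>G\<^esub> b" "pos a < pos b"
    and left: "\<And>w. w \<in> verts G \<Longrightarrow> pos w \<le> pos a \<Longrightarrow> w \<rightarrow>\<^bsub>G\<^esub> b"
    and right: "\<And>w. w \<in> verts G \<Longrightarrow> pos b \<le> pos w \<Longrightarrow> w \<rightarrow>\<^bsub>G\<^esub> a"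
  shows "\<exists>q. vpath q G \<and> (\<forall>w\<in>verts G. within_two G (set q) w)"
proof -
  interpret convex_neighbourhoods G pos by fact
  define N where "N = {v. v \<rightarrow>\<^bsub>G\<^esub> b \<and> pos v < pos b}"
  have "finite N"
    by (rule finite_subset[OF _ finite_verts]) (auto simp: N_def adj_in_verts)
  moreover have "a \<in> N" using ab by (simp add: N_def)
  ultimately obtain c where "is_arg_min (\<lambda>v. - pos v) (\<lambda>v. v \<in> N) c"
    using ex_is_arg_min_if_finite[of N "\<lambda>v. - pos v"] by blast
  then have c: "c \<rightarrow>\<^bsub>G\<^esub> b" "pos c < pos b" and c_max: "\<And>v. v \<in> N \<Longrightarrow> pos v \<le> pos c"
    by (auto simp: is_arg_min_linorder N_def)
  have "pos a \<le> pos c" using c_max \<open>a \<in> N\<close> by blast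
  have verts: "a \<in> verts G" "b \<in> verts G" "c \<in> verts G" using ab c adj_in_verts by auto
  define p where "p = (if c = a then [c, b] else [c, b, a])"
  have set_p: "set p = {a, b, c}" by (auto simp: p_def)
  show ?thesis
  proof (rule spiral_into_gap[OF \<open>convex_neighbourhoods G pos\<close> conn])
    show "vpath p G" using ab c verts adj_sym[OF ab(1)] by (auto simp: p_def vpath_def vwalk_def)
    show "hd p = c" by (simp add: p_def)
    show "b \<rightarrow>\<^bsub>G\<^esub> c" using c(1) by (rule adj_sym)
    show "pos c < pos b" by fact
    show "pos x \<le> pos c \<or> pos b \<le> pos x" if "x \<in> set p" for x
      using that \<open>pos a \<le> pos c\<close> by (auto simp: set_p)
    show "dominated G (set p) w" if w: "w \<in> verts G" "pos w \<le> pos c \<or> pos b \<le> pos w" for w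
    proof -
      have "w \<rightarrow>\<^bsub>G\<^esub> b \<or> w \<rightarrow>\<^bsub>G\<^esub> a"
        using w left right convex[OF ab(1) c(1) w(1)] c(2) by force
      then show ?thesis by (auto simp: dominated_def set_p)
    qed
    show "pos g \<le> pos c" if "g \<rightarrow>\<^bsub>G\<^esub> b" "pos g < pos b" for g
      using that c_max by (simp add: N_def)
  qed
qed

section \<open>A path at distance at most two from every vertex\<close>

theorem (in convex_neighbourhoods) ex_path_within_two:
  assumes conn: "strongly_connected G"
  obtains q where "vpath q G" "\<And>w. w \<in> verts G \<Longrightarrow> within_two G (set q) w"
proof -
  have "verts G \<noteq> {}" using conn by (auto simp: strongly_connected_def)
  then obtain s t where "is_arg_min pos (\<lambda>v. v \<in> verts G) s"
    and "is_arg_min (\<lambda>v. - pos v) (\<lambda>v. v \<in> verts G) t"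
    using ex_is_arg_min_if_finite[OF finite_verts] by metis
  then have s: "s \<in> verts G" "\<And>w. w \<in> verts G \<Longrightarrow> pos s \<le> pos w"
    and t: "t \<in> verts G" "\<And>w. w \<in> verts G \<Longrightarrow> pos w \<le> pos t"
    by (simp_all add: is_arg_min_linorder)
  have "s \<rightarrow>\<^sup>*\<^bsub>G\<^esub> t" using conn s t by (auto simp: strongly_connected_def)
  then obtain p where p: "vpath p G" "hd p = s" "last p = t"
    using reachable_vpath_conv by blast
  then have walk: "vwalk p G" and "p \<noteq> []" by (auto simp: vpath_def vwalk_def)
  then obtain k where k: "length p = Suc k" by (cases p) auto
  have ends: "p ! 0 = s" "p ! k = t"
    using p \<open>p \<noteq> []\<close> k by (simp_all add: hd_conv_nth last_conv_nth)
  have p_verts: "p ! i \<in> verts G" if "i \<le> k" for i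
    using that k walk by (auto simp: vwalk_def)
  show thesis
  proof (cases "\<forall>w\<in>verts G. within_two G (set p) w")
    case True
    then show ?thesis using that p(1) by blast
  next
    case False
    then obtain w where w: "w \<in> verts G" "\<not> within_two G (set p) w" by blast
    have "odd k"
    proof
      assume "even k"
      then obtain m where "k = 0 + 2 * m" by auto
      then have "dominated G (set p) w"
        using dominated_between_same_parity[OF walk, of 0 m w] w(1) s t k ends by simp
      with w(2) show False by (simp add: within_two_def)
    qed
    then obtain m where m: "k = Suc (2 * m)" by (auto elim: oddE)
    \<comment> \<open>\<open>?a\<close> is the last vertex of even index and \<open>?b\<close> the first of odd index. As the indices of
      the two ends \<open>s\<close> and \<open>t\<close> are \<open>0\<close> and the odd number \<open>k\<close>, each parity covers one side.\<close>
    let ?a = "p ! (2 * m)" and ?b = "p ! Suc 0"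
    have sb: "s \<rightarrow>\<^bsub>G\<^esub> ?b" and ta: "t \<rightarrow>\<^bsub>G\<^esub> ?a"
      using vwalk_nth_adj[OF walk, of 0] vwalk_nth_adj[OF walk, of "2 * m"] k m ends adj_sym by auto
    have low: "dominated G (set p) v" if "v \<in> verts G" "pos v \<le> pos ?a" for v
      using dominated_between_same_parity[OF walk, of 0 m v] that s ends k m by simp
    have high: "dominated G (set p) v" if "v \<in> verts G" "pos ?b \<le> pos v" for v
      using dominated_between_same_parity[OF walk, of 1 m v] that t ends k m by simp
    have ab: "?a \<in> verts G" "?b \<in> verts G" using p_verts m by auto
    obtain g where g: "pos ?a < pos g" "pos g < pos ?b" "g \<rightarrow>\<^bsub>G\<^esub> ?a \<or> g \<rightarrow>\<^bsub>G\<^esub> ?b"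
      using gap_attached_to_boundary[OF conn ab _ w] low high by blast
    then have lt: "pos ?a < pos ?b" by simp
    \<comment> \<open>A neighbourhood that reaches from \<open>g\<close> to an end of the order contains the far side of the gap.\<close>
    have "?a \<rightarrow>\<^bsub>G\<^esub> ?b"
      using g(3)
    proof
      assume "g \<rightarrow>\<^bsub>G\<^esub> ?a"
      then have "?b \<rightarrow>\<^bsub>G\<^esub> ?a" using convex[OF _ ta ab(2)] g(2) t(2)[OF ab(2)] lt by force
      then show ?thesis by (rule adj_sym)
    next
      assume "g \<rightarrow>\<^bsub>G\<^esub> ?b"
      then show ?thesis using convex[OF sb _ ab(1)] g(1) s(2)[OF ab(1)] lt by force
    qed
    moreover have "v \<rightarrow>\<^bsub>G\<^esub> ?b" if "v \<in> verts G" "pos v \<le> pos ?a" for v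
      using convex[OF sb \<open>?a \<rightarrow>\<^bsub>G\<^esub> ?b\<close> that(1)] that s(2) lt by force
    moreover have "v \<rightarrow>\<^bsub>G\<^esub> ?a" if "v \<in> verts G" "pos ?b \<le> pos v" for v
      using convex[OF adj_sym[OF \<open>?a \<rightarrow>\<^bsub>G\<^esub> ?b\<close>] ta that(1)] that t(2) lt by force
    ultimately show ?thesis
      using path_from_bridging_edge[OF convex_neighbourhoods_axioms conn _ lt] that by blast
  qed
qed

section \<open>From matrices to orderings\<close>

lemma partially_augmented_C1P_imp_convex_neighbourhoods:
  assumes "graph G" "partially_augmented_C1P G"
  obtains pos where "convex_neighbourhoods G pos"
proof -
  interpret graph G by fact
  let ?n = "card (verts G)"
  obtain A A' where "is_adjacency_mat G A"
    and dim: "A' \<in> carrier_mat ?n ?n"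
    and offdiag: "\<And>i j. i < ?n \<Longrightarrow> j < ?n \<Longrightarrow> i \<noteq> j \<Longrightarrow> A' $$ (i, j) = A $$ (i, j)"
    and "C1P A'"
    using assms(2) unfolding partially_augmented_C1P_def by blast
  then obtain f \<pi> where f: "bij_betw f {0..<?n} (verts G)"
    and A: "A = mat ?n ?n (\<lambda>(i, j). if f i \<rightarrow>\<^bsub>G\<^esub> f j then 1 else 0)"
    and \<pi>: "\<pi> permutes {0..<?n}"
    and consec: "ones_consecutive_in_columns (permute_rows \<pi> A')"
    unfolding is_adjacency_mat_def C1P_def by auto
  \<comment> \<open>The vertex in row \<open>i\<close> of the permuted matrix is \<open>f (\<pi> i)\<close>; columns are not permuted and remain
    indexed by \<open>f\<close>, so the column of \<open>v\<close> is \<open>\<pi> (rank v)\<close>.\<close>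
  define h where "h = f \<circ> \<pi>"
  have h: "bij_betw h {0..<?n} (verts G)"
    unfolding h_def using permutes_imp_bij[OF \<pi>] f by (rule bij_betw_trans)
  define rank where "rank = the_inv_into {0..<?n} h"
  have rank: "rank v < ?n" "f (\<pi> (rank v)) = v" "\<pi> (rank v) < ?n" if "v \<in> verts G" for v
  proof -
    show "rank v < ?n"
      using bij_betw_apply[OF bij_betw_the_inv_into[OF h] that] by (simp add: rank_def)
    then show "\<pi> (rank v) < ?n" using permutes_in_image[OF \<pi>, of "rank v"] by simp
    show "f (\<pi> (rank v)) = v"
      using f_the_inv_into_f_bij_betw[OF h, of v] that by (simp add: rank_def h_def)
  qed
  have entry: "A' $$ (\<pi> (rank u), \<pi> (rank v)) = (if u \<rightarrow>\<^bsub>G\<^esub> v then 1 else 0)"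
    if "u \<in> verts G" "v \<in> verts G" "u \<noteq> v" for u v
  proof -
    have "\<pi> (rank u) \<noteq> \<pi> (rank v)" using that rank(2) by metis
    then show ?thesis using offdiag rank that by (simp add: A)
  qed
  have "convex_neighbourhoods G (\<lambda>v. int (rank v))"
  proof unfold_locales
    show "inj_on (\<lambda>v. int (rank v)) (verts G)"
      using rank(2) by (intro inj_onI) (metis of_nat_eq_iff)
  next
    fix x v y w
    assume x: "x \<rightarrow>\<^bsub>G\<^esub> v" and y: "y \<rightarrow>\<^bsub>G\<^esub> v" and w: "w \<in> verts G" "w \<noteq> v"
      and le: "int (rank x) \<le> int (rank w)" "int (rank w) \<le> int (rank y)"
    have verts: "x \<in> verts G" "y \<in> verts G" "v \<in> verts G" using x y adj_in_verts by auto
    have "x \<noteq> v" "y \<noteq> v" using x y adj_not_same by auto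
    then have ones: "A' $$ (\<pi> (rank x), \<pi> (rank v)) = 1" "A' $$ (\<pi> (rank y), \<pi> (rank v)) = 1"
      using entry verts x y by auto
    have "\<forall>j < ?n. \<forall>i k l. i \<le> k \<longrightarrow> k \<le> l \<longrightarrow> l < ?n \<longrightarrow>
        A' $$ (\<pi> i, j) = 1 \<longrightarrow> A' $$ (\<pi> l, j) = 1 \<longrightarrow> A' $$ (\<pi> k, j) = 1"
      using consec dim unfolding ones_consecutive_in_columns_def permute_rows_def by auto
    then have "A' $$ (\<pi> (rank w), \<pi> (rank v)) = 1"
      using ones le rank verts by simp
    then show "w \<rightarrow>\<^bsub>G\<^esub> v" using entry[OF w(1) verts(3) w(2)] by (metis zero_neq_one)
  qed
  then show thesis by (rule that)
qed

section \<open>Path eccentricity\<close>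

lemma (in graph) graph_dist_set_le_two:
  assumes "within_two G S w" "w \<in> verts G"
  shows "graph_dist_set G w S \<le> 2"
proof -
  have "\<exists>x\<in>S. \<exists>p. vpath p G \<and> hd p = w \<and> last p = x \<and> length p \<le> 3"
  proof -
    have irrefl: "\<not> v \<rightarrow>\<^bsub>G\<^esub> v" for v using adj_not_same by blast
    consider x where "x \<in> S" "w = x"
      | x where "x \<in> S" "w \<noteq> x" "w \<rightarrow>\<^bsub>G\<^esub> x"
      | u x where "x \<in> S" "w \<noteq> x" "w \<noteq> u" "u \<noteq> x" "w \<rightarrow>\<^bsub>G\<^esub> u" "u \<rightarrow>\<^bsub>G\<^esub> x"
      using assms(1) irrefl unfolding within_two_def dominated_def by metis
    then show ?thesis
    proof cases
      case 1
      then show ?thesis using vpath_self[OF assms(2)] by force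
    next
      case 2
      then have "vpath [w, x] G" by (auto simp: vpath_def vwalk_def adj_in_verts)
      then show ?thesis using 2(1) by force
    next
      case 3
      then have "vpath [w, u, x] G" by (auto simp: vpath_def vwalk_def adj_in_verts)
      then show ?thesis using 3(1) by force
    qed
  qed
  then obtain x p where x: "x \<in> S" and p: "vpath p G" "hd p = w" "last p = x" "length p \<le> 3"
    by blast
  have "graph_dist_set G w S \<le> graph_dist G w x"
    unfolding graph_dist_set_def using x by (rule INF_lower)
  also have "\<dots> \<le> enat (vwalk_length p)"
    unfolding graph_dist_def using p by (intro INF_lower) simp
  also have "\<dots> \<le> 2" using p(4) by (simp add: numeral_eq_enat)
  finally show ?thesis .
qed

theorem corollary5:
  fixes G :: "('a, 'b) pre_digraph"
  assumes "graph G"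
    and "Digraph_Component.connected G"
    and "partially_augmented_C1P G"
  shows "path_eccentricity G \<le> 2"
proof -
  obtain pos where "convex_neighbourhoods G pos"
    using partially_augmented_C1P_imp_convex_neighbourhoods assms(1,3) by blast
  then interpret convex_neighbourhoods G pos .
  have "strongly_connected G"
    using symmetric_connected_imp_strongly_connected[OF sym_arcs] assms(2) .
  then obtain q where q: "vpath q G" "\<And>w. w \<in> verts G \<Longrightarrow> within_two G (set q) w"
    using ex_path_within_two by blast
  have "path_eccentricity G \<le> path_ecc G q"
    unfolding path_eccentricity_def using q(1) by (intro INF_lower) simp
  also have "\<dots> \<le> 2"
    unfolding path_ecc_def using q(2) graph_dist_set_le_two by (intro SUP_least) simp
  finally show ?thesis .
qed

end
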